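(* Let $\eta\ge0$, $\delta\in(0,1/2)$, and let $(T,\mathcal L)$ be a $\beta$-extra list edge coloring instance on a tree of maximum degree $\Delta$, rooted at $r$ with children $v_1,\dots,v_d$, $e_i=\{r,v_i\}$, where $\beta\ge1+\frac{(1+\eta)\Delta}{\sqrt{1-2\delta}}$. For each $i\in[d]$ let $\mathbf p_i$ be a probability distribution on $C_{v_i}$, let $\mathbf p_r=f(\mathbf p_1,\dots,\mathbf p_d)$, and suppose: (i) for every $i$ and color $a$, $\mathbf p_i(a)\le\frac{|E_{T_{v_i}}(v_i)|}{\beta-1+|E_{T_{v_i}}(v_i)|}$ and $\frac{\mathbf p_r(i,a)}{\mathbf p_i(\bar a)}\le\frac{1}{\beta-1}$; (ii) each $\mathbf p_i$ and $\mathbf p_r$ is $(1+\eta)$-spectrally independent. Let $\phi(x)=2\sqrt x$ and $\mathbf m=\phi(\mathbf p)$ (componentwise). Then \[\big\|\mathcal Jf^\phi(\mathbf m)\big\|_2\le\frac{1-\delta}{\sqrt\Delta}.\]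
   Context: Lists $\mathcal L(e)\subseteq[q]$; $\beta$-extra means $|\mathcal L(e)|\ge\deg(e)+\beta$ where $\deg(e)$ is the number of edges other than $e$ sharing an endpoint with $e$. For a vertex $u$, $E_{T_u}(u)$ is the set of edges from $u$ to its children and $C_u$ the set of proper partial colorings of it (colors from lists, pairwise distinct). For $\mathbf p\in\mathbb R_{\ge0}^{C_u}$: $\mathbf p(c)=\sum_{\tau:c\in\tau}\mathbf p(\tau)$, $\mathbf p(\bar c)=\sum_{\tau:c\notin\tau}\mathbf p(\tau)$. The map $f=(f_\pi)_{\pi\in C_r}$ on $\prod_i\mathbb R_{\ge0}^{C_{v_i}}$ is $f_\pi(\mathbf p_1,\dots,\mathbf p_d)=\frac{\prod_i\mathbf p_i(\overline{\pi(e_i)})}{\sum_{\rho\in C_r}\prod_i\mathbf p_i(\overline{\rho(e_i)})}$; $\mathbf p_r(i,c)=\sum_{\pi:\pi(e_i)=c}\mathbf p_r(\pi)$. Define $f^\phi_\pi(\mathbf m)=\phi\big(f_\pi(\phi^{-1}(\mathbf m_1),\dots,\phi^{-1}(\mathbf m_d))\big)$ with $\phi^{-1}$ applied componentwise; $\mathcal Jf^\phi(\mathbf m)$ is its Jacobian matrix, rows indexed by $\pi\in C_r$ and columns by pairs $(i,\tau)$, $\tau\in C_{v_i}$, and $\|\cdot\|_2$ is the spectral norm. For a distribution $\mathbf p$ on $C_u$ with broom $E_{T_u}(u)=\{e_1,\dots,e_m\}$, let $X_u=\{(i,c):i\in[m],c\in\mathcal L(e_i)\}$; $\mathrm{Cov}(\mathbf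 p)\in\mathbb R^{X_u\times X_u}$ has entries $\mathrm{Cov}(\mathbf p)((i,c_1),(j,c_2))=\Pr_{\tau\sim\mathbf p}[\tau(e_i)=c_1,\tau(e_j)=c_2]-\Pr[\tau(e_i)=c_1]\Pr[\tau(e_j)=c_2]$, and $\Pi(\mathbf p)$ is the diagonal matrix with entries $\Pr_{\tau\sim\mathbf p}[\tau(e_i)=c]$. $\mathbf p$ is $C$-spectrally independent if $\mathrm{Cov}(\mathbf p)\preceq C\,\Pi(\mathbf p)$ in Loewner order. *)

theory Defs
  imports "HOL-Analysis.Analysis"
begin

section \<open>Trees\<close>

definition simple_graph :: "'v set \<Rightarrow> 'v set set \<Rightarrow> bool" where
  "simple_graph V E \<longleftrightarrow> finite V \<and> (\<forall>e\<in>E. e \<subseteq> V \<and> card e = 2)"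

definition is_path :: "'v set \<Rightarrow> 'v set set \<Rightarrow> 'v list \<Rightarrow> bool" where
  "is_path V E xs \<longleftrightarrow> xs \<noteq> [] \<and> set xs \<subseteq> V \<and> distinct xs \<and> successively (\<lambda>x y. {x, y} \<in> E) xs"

definition connected_graph :: "'v set \<Rightarrow> 'v set set \<Rightarrow> bool" where
  "connected_graph V E \<longleftrightarrow>
     V \<noteq> {} \<and> (\<forall>x\<in>V. \<forall>y\<in>V. \<exists>xs. is_path V E xs \<and> hd xs = x \<and> last xs = y)"

definition is_cycle :: "'v set \<Rightarrow> 'v set set \<Rightarrow> 'v list \<Rightarrow> bool" where
  "is_cycle V E xs \<longleftrightarrow> is_path V E xs \<and> length xs \<ge> 3 \<and> {last xs, hd xs} \<in> E"

definition is_tree :: "'v set \<Rightarrow> 'v set set \<Rightarrow> bool" where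
  "is_tree V E \<longleftrightarrow> simple_graph V E \<and> connected_graph V E \<and> (\<nexists>xs. is_cycle V E xs)"

definition vertex_degree :: "'v set set \<Rightarrow> 'v \<Rightarrow> nat" where
  "vertex_degree E u = card {e \<in> E. u \<in> e}"

definition max_degree :: "'v set \<Rightarrow> 'v set set \<Rightarrow> nat" where
  "max_degree V E = Max (vertex_degree E ` V)"

definition edge_degree :: "'v set set \<Rightarrow> 'v set \<Rightarrow> nat" where
  "edge_degree E e = card {e' \<in> E. e' \<noteq> e \<and> e' \<inter> e \<noteq> {}}"

text \<open>In the tree rooted at \<open>r\<close>, \<open>w\<close> is a child of \<open>u\<close> if \<open>u\<close> immediately precedes \<open>w\<close> on the path
  from \<open>r\<close> to \<open>w\<close>.\<close>

definition children :: "'v set \<Rightarrow> 'v set set \<Rightarrow> 'v \<Rightarrow> 'v \<Rightarrow> 'v set" where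
  "children V E r u = {w. \<exists>xs. is_path V E (xs @ [u, w]) \<and> hd (xs @ [u, w]) = r}"

text \<open>The broom \<open>E\<^bsub>T\<^sub>u\<^esub>(u)\<close>.\<close>

definition broom :: "'v set \<Rightarrow> 'v set set \<Rightarrow> 'v \<Rightarrow> 'v \<Rightarrow> 'v set set" where
  "broom V E r u = {{u, w} | w. w \<in> children V E r u}"


section \<open>List edge colorings\<close>

definition extra_instance ::
    "real \<Rightarrow> 'v set \<Rightarrow> 'v set set \<Rightarrow> nat \<Rightarrow> ('v set \<Rightarrow> nat set) \<Rightarrow> bool" where
  "extra_instance \<beta> V E q L \<longleftrightarrow>
     is_tree V E \<and>
     (\<forall>e\<in>E. L e \<subseteq> {1..q} \<and> real (card (L e)) \<ge> real (edge_degree E e) + \<beta>)"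

text \<open>The proper list colorings of a broom \<open>B\<close>: every edge of \<open>B\<close> is colored, and as all edges of \<open>B\<close>
  share an endpoint, proper means injective. They are partial colorings of the tree, in that only
  the edges of \<open>B\<close> are colored (the value is \<open>undefined\<close> elsewhere).\<close>

definition colorings :: "('v set \<Rightarrow> nat set) \<Rightarrow> 'v set set \<Rightarrow> ('v set \<Rightarrow> nat) set" where
  "colorings L B = {\<tau> \<in> Pi\<^sub>E B L. inj_on \<tau> B}"

text \<open>Vectors in \<open>\<real>\<^bsup>C\<^esup>\<close> are functions of which only the values on \<open>C\<close> matter. \<open>mass L B p P\<close> is the
  probability of the event \<open>P\<close> under \<open>p\<close> if \<open>p\<close> is a distribution on the colorings of \<open>B\<close>.\<close>

definition distribution_on :: "'a set \<Rightarrow> ('a \<Rightarrow> real) \<Rightarrow> bool" where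
  "distribution_on S p \<longleftrightarrow> (\<forall>x\<in>S. p x \<ge> 0) \<and> (\<Sum>x\<in>S. p x) = 1"

definition mass ::
    "('v set \<Rightarrow> nat set) \<Rightarrow> 'v set set \<Rightarrow> (('v set \<Rightarrow> nat) \<Rightarrow> real) \<Rightarrow> (('v set \<Rightarrow> nat) \<Rightarrow> bool) \<Rightarrow> real" where
  "mass L B p P = (\<Sum>\<tau> \<in> {\<tau> \<in> colorings L B. P \<tau>}. p \<tau>)"

text \<open>\<open>p(c)\<close>, \<open>p(c\<^bsup>-\<^esup>)\<close> (the color \<open>c\<close> does not occur) and \<open>p(e, c)\<close>.\<close>

definition color_mass ::
    "('v set \<Rightarrow> nat set) \<Rightarrow> 'v set set \<Rightarrow> (('v set \<Rightarrow> nat) \<Rightarrow> real) \<Rightarrow> nat \<Rightarrow> real" where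
  "color_mass L B p c = mass L B p (\<lambda>\<tau>. c \<in> \<tau> ` B)"

definition avoid_mass ::
    "('v set \<Rightarrow> nat set) \<Rightarrow> 'v set set \<Rightarrow> (('v set \<Rightarrow> nat) \<Rightarrow> real) \<Rightarrow> nat \<Rightarrow> real" where
  "avoid_mass L B p c = mass L B p (\<lambda>\<tau>. c \<notin> \<tau> ` B)"

definition edge_mass ::
    "('v set \<Rightarrow> nat set) \<Rightarrow> 'v set set \<Rightarrow> (('v set \<Rightarrow> nat) \<Rightarrow> real) \<Rightarrow> 'v set \<Rightarrow> nat \<Rightarrow> real" where
  "edge_mass L B p e c = mass L B p (\<lambda>\<tau>. \<tau> e = c)"


section \<open>Spectral independence\<close>

text \<open>Matrices with finite index sets are functions of the row and column index. The index \<open>i\<close> of an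
  edge \<open>e\<^sub>i\<close> of a broom is replaced by the edge itself.\<close>

definition psd_on :: "'a set \<Rightarrow> ('a \<Rightarrow> 'a \<Rightarrow> real) \<Rightarrow> bool" where
  "psd_on X M \<longleftrightarrow>
     (\<forall>a\<in>X. \<forall>b\<in>X. M a b = M b a) \<and> (\<forall>x. (\<Sum>a\<in>X. \<Sum>b\<in>X. x a * M a b * x b) \<ge> 0)"

definition loewner_le :: "'a set \<Rightarrow> ('a \<Rightarrow> 'a \<Rightarrow> real) \<Rightarrow> ('a \<Rightarrow> 'a \<Rightarrow> real) \<Rightarrow> bool" where
  "loewner_le X A B \<longleftrightarrow> psd_on X (\<lambda>a b. B a b - A a b)"

definition Cov ::
    "('v set \<Rightarrow> nat set) \<Rightarrow> 'v set set \<Rightarrow> (('v set \<Rightarrow> nat) \<Rightarrow> real)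
      \<Rightarrow> 'v set \<times> nat \<Rightarrow> 'v set \<times> nat \<Rightarrow> real" where
  "Cov L B p = (\<lambda>(e, c) (e', c').
     mass L B p (\<lambda>\<tau>. \<tau> e = c \<and> \<tau> e' = c') - edge_mass L B p e c * edge_mass L B p e' c')"

definition Diag ::
    "('v set \<Rightarrow> nat set) \<Rightarrow> 'v set set \<Rightarrow> (('v set \<Rightarrow> nat) \<Rightarrow> real)
      \<Rightarrow> 'v set \<times> nat \<Rightarrow> 'v set \<times> nat \<Rightarrow> real" where
  "Diag L B p = (\<lambda>(e, c) (e', c'). if (e, c) = (e', c') then edge_mass L B p e c else 0)"

definition spectrally_independent ::
    "real \<Rightarrow> ('v set \<Rightarrow> nat set) \<Rightarrow> 'v set set \<Rightarrow> (('v set \<Rightarrow> nat) \<Rightarrow> real) \<Rightarrow> bool" where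
  "spectrally_independent C L B p \<longleftrightarrow>
     loewner_le (SIGMA e:B. L e) (Cov L B p) (\<lambda>a b. C * Diag L B p a b)"


section \<open>The tree recursion and its Jacobian\<close>

text \<open>The root is \<open>r\<close>, its children are \<open>v 1, \<dots>, v d\<close> and \<open>e\<^sub>i\<close> is \<open>{r, v i}\<close>.\<close>

definition tree_rec ::
    "'v set \<Rightarrow> 'v set set \<Rightarrow> ('v set \<Rightarrow> nat set) \<Rightarrow> 'v \<Rightarrow> nat \<Rightarrow> (nat \<Rightarrow> 'v)
      \<Rightarrow> (nat \<Rightarrow> ('v set \<Rightarrow> nat) \<Rightarrow> real) \<Rightarrow> ('v set \<Rightarrow> nat) \<Rightarrow> real" where
  "tree_rec V E L r d v p \<pi> =
     (\<Prod>i=1..d. avoid_mass L (broom V E r (v i)) (p i) (\<pi> {r, v i})) /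
     (\<Sum>\<rho>\<in>colorings L (broom V E r r).
        \<Prod>i=1..d. avoid_mass L (broom V E r (v i)) (p i) (\<rho> {r, v i}))"

definition phi :: "real \<Rightarrow> real" where
  "phi x = 2 * sqrt x"

text \<open>The inverse of \<open>phi\<close> on the nonnegative reals. Being defined on all of \<open>\<real>\<close>, it lets one take
  ordinary (two-sided) partial derivatives also at points with vanishing coordinates.\<close>

definition phi_inv :: "real \<Rightarrow> real" where
  "phi_inv y = y\<^sup>2 / 4"

lemma phi_inv_phi: "x \<ge> 0 \<Longrightarrow> phi_inv (phi x) = x"
  by (simp add: phi_def phi_inv_def power_mult_distrib)

lemma phi_phi_inv: "y \<ge> 0 \<Longrightarrow> phi (phi_inv y) = y"
  by (simp add: phi_def phi_inv_def real_sqrt_divide)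

definition tree_rec_phi ::
    "'v set \<Rightarrow> 'v set set \<Rightarrow> ('v set \<Rightarrow> nat set) \<Rightarrow> 'v \<Rightarrow> nat \<Rightarrow> (nat \<Rightarrow> 'v)
      \<Rightarrow> (nat \<Rightarrow> ('v set \<Rightarrow> nat) \<Rightarrow> real) \<Rightarrow> ('v set \<Rightarrow> nat) \<Rightarrow> real" where
  "tree_rec_phi V E L r d v m \<pi> = phi (tree_rec V E L r d v (\<lambda>i \<tau>. phi_inv (m i \<tau>)) \<pi>)"

definition jacobian_entries ::
    "((nat \<Rightarrow> 'c \<Rightarrow> real) \<Rightarrow> 'b \<Rightarrow> real) \<Rightarrow> (nat \<Rightarrow> 'c \<Rightarrow> real) \<Rightarrow> 'b \<Rightarrow> nat \<times> 'c \<Rightarrow> real" where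
  "jacobian_entries F m = (\<lambda>\<pi> (i, \<tau>). deriv (\<lambda>t. F (m(i := (m i)(\<tau> := t))) \<pi>) (m i \<tau>))"

text \<open>The operator norm with respect to the Euclidean norms of a matrix with rows indexed by \<open>R\<close> and
  columns by \<open>S\<close>. The unit ball instead of the unit sphere accounts for empty \<open>S\<close>.\<close>

definition spectral_norm :: "'a set \<Rightarrow> 'b set \<Rightarrow> ('a \<Rightarrow> 'b \<Rightarrow> real) \<Rightarrow> real" where
  "spectral_norm R S M = (SUP x\<in>{x. L2_set x S \<le> 1}. L2_set (\<lambda>a. \<Sum>b\<in>S. M a b * x b) R)"

end

theory Submission
  imports Defs
begin

text \<open>
  The Jacobian has entries \<open>\<surd>p\<^sub>r(\<pi>) \<surd>p\<^sub>i(\<tau>) (g(\<pi>) - E g)\<close>, where the expectation is over \<open>p\<^sub>r\<close> and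
  \<open>g(\<pi>)\<close> is the indicator of \<open>\<pi>(e\<^sub>i) \<notin> \<tau>\<close> divided by the probability that \<open>p\<^sub>i\<close> avoids \<open>\<pi>(e\<^sub>i)\<close>.
  Hence the squared norm of its product with a vector \<open>x\<close> is the variance under \<open>p\<^sub>r\<close> of a sum
  \<open>\<Sum>i. h\<^sub>i(\<pi>(e\<^sub>i))\<close>. Spectral independence of \<open>p\<^sub>r\<close> bounds it by
  \<open>(1 + \<eta>) \<Sum>i. \<Sum>c. p\<^sub>r(i, c) h\<^sub>i(c)\<^sup>2\<close>, where each \<open>h\<^sub>i\<close> may first be shifted by a constant. With the
  right shift, \<open>h\<^sub>i(c)\<close> is up to sign \<open>a\<^sub>c\<close> divided by the probability that \<open>p\<^sub>i\<close> avoids \<open>c\<close>, where \<open>a\<^sub>c\<close> is the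
  covariance under \<open>p\<^sub>i\<close> of \<open>x\<^sub>i / \<surd>p\<^sub>i\<close> and the event \<open>c \<in> \<tau>\<close>. Spectral independence of \<open>p\<^sub>i\<close> and
  duality bound \<open>\<Sum>c. a\<^sub>c\<^sup>2\<close> by \<open>(1 + \<eta>) max\<^sub>c p\<^sub>i(c)\<close> times the squared norm of \<open>x\<^sub>i\<close>, and the marginal
  bounds give \<open>(1 + \<eta>)\<^sup>2 \<Delta> / (\<beta> - 1)\<^sup>2 \<le> (1 - 2\<delta>) / \<Delta>\<close> in total.
\<close>

section \<open>Masses and sums over the colorings of a broom\<close>

lemma finite_colorings:
  assumes "finite B" and "\<And>e. e \<in> B \<Longrightarrow> finite (L e)"
  shows "finite (colorings L B)"
proof (rule finite_subset)
  show "colorings L B \<subseteq> Pi\<^sub>E B L"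
    by (auto simp: colorings_def)
  show "finite (Pi\<^sub>E B L)"
    using assms by (intro finite_PiE)
qed

lemma coloring_in_list: "\<tau> \<in> colorings L B \<Longrightarrow> e \<in> B \<Longrightarrow> \<tau> e \<in> L e"
  by (auto simp: colorings_def)

lemma mass_eq_sum_of_bool:
  assumes "finite (colorings L B)"
  shows "mass L B p P = (\<Sum>\<tau>\<in>colorings L B. of_bool (P \<tau>) * p \<tau>)"
  unfolding mass_def
  by (subst sum.inter_filter[OF assms]) (auto intro!: sum.cong)

lemma color_mass_add_avoid_mass:
  assumes "finite (colorings L B)"
  shows "color_mass L B p c + avoid_mass L B p c = sum p (colorings L B)"
  unfolding color_mass_def avoid_mass_def mass_eq_sum_of_bool[OF assms] sum.distrib[symmetric]
  by (intro sum.cong) auto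

text \<open>Regrouping an expectation by the color of a single edge lets a bound on the marginals of
  that edge act color by color.\<close>

lemma sum_coloring_eq_sum_edge_mass:
  assumes "finite B" and "\<And>e. e \<in> B \<Longrightarrow> finite (L e)" and "e \<in> B"
  shows "(\<Sum>\<tau>\<in>colorings L B. p \<tau> * z (\<tau> e)) = (\<Sum>c\<in>L e. edge_mass L B p e c * z c)"
proof -
  have fC: "finite (colorings L B)"
    using assms(1,2) by (rule finite_colorings)
  have "(\<Sum>c\<in>L e. edge_mass L B p e c * z c) =
      (\<Sum>c\<in>L e. \<Sum>\<tau>\<in>colorings L B. of_bool (\<tau> e = c) * p \<tau> * z c)"
    unfolding edge_mass_def mass_eq_sum_of_bool[OF fC]
    by (simp add: sum_distrib_right)
  also have "\<dots> = (\<Sum>\<tau>\<in>colorings L B. \<Sum>c\<in>L e. of_bool (\<tau> e = c) * p \<tau> * z c)"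
    by (rule sum.swap)
  also have "\<dots> = (\<Sum>\<tau>\<in>colorings L B. p \<tau> * z (\<tau> e))"
  proof (rule sum.cong)
    fix \<tau> assume "\<tau> \<in> colorings L B"
    then have "\<tau> e \<in> L e" using assms(3) by (rule coloring_in_list)
    have "(\<Sum>c\<in>L e. of_bool (\<tau> e = c) * p \<tau> * z c) =
        (\<Sum>c\<in>L e. if \<tau> e = c then p \<tau> * z c else 0)"
      by (intro sum.cong) auto
    also have "\<dots> = p \<tau> * z (\<tau> e)"
      using assms(2)[OF assms(3)] \<open>\<tau> e \<in> L e\<close> by simp
    finally show "(\<Sum>c\<in>L e. of_bool (\<tau> e = c) * p \<tau> * z c) = p \<tau> * z (\<tau> e)" .
  qed simp
  finally show ?thesis ..
qed

text \<open>A proper coloring uses each color on at most one edge, so edges can be traded for the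
  colors that occur. This links spectral independence, indexed by pairs of edge and color, to the
  events that a color is used somewhere in the broom.\<close>

lemma sum_coloring_eq_sum_used:
  fixes z :: "nat \<Rightarrow> real"
  assumes "\<tau> \<in> colorings L B" and "finite B" and "finite A"
  shows "(\<Sum>e\<in>B. if \<tau> e \<in> A then z (\<tau> e) else 0) = (\<Sum>c\<in>A. of_bool (c \<in> \<tau> ` B) * z c)"
proof -
  have "inj_on \<tau> B"
    using assms(1) by (auto simp: colorings_def)
  then have "(\<Sum>e\<in>B. if \<tau> e \<in> A then z (\<tau> e) else 0) = (\<Sum>c\<in>\<tau> ` B. if c \<in> A then z c else 0)"
    by (simp add: sum.reindex)
  also have "\<dots> = sum z (\<tau> ` B \<inter> A)"
    using assms(2) by (simp add: sum.inter_restrict)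
  also have "\<dots> = (\<Sum>c\<in>A. if c \<in> \<tau> ` B then z c else 0)"
    using assms(3) by (simp add: sum.inter_restrict Int_commute)
  also have "\<dots> = (\<Sum>c\<in>A. of_bool (c \<in> \<tau> ` B) * z c)"
    by (intro sum.cong) auto
  finally show ?thesis .
qed

section \<open>Variance bounds from spectral independence\<close>

lemma variance_eq:
  fixes p S :: "'a \<Rightarrow> real"
  assumes "sum p C = 1"
  shows "(\<Sum>x\<in>C. p x * (S x - (\<Sum>y\<in>C. p y * S y))\<^sup>2) =
    (\<Sum>x\<in>C. p x * (S x)\<^sup>2) - (\<Sum>x\<in>C. p x * S x)\<^sup>2"
proof -
  define \<mu> where "\<mu> = (\<Sum>y\<in>C. p y * S y)"
  have "(\<Sum>x\<in>C. p x * (S x - \<mu>)\<^sup>2) =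
      (\<Sum>x\<in>C. p x * (S x)\<^sup>2 - 2 * \<mu> * (p x * S x) + \<mu>\<^sup>2 * p x)"
    by (intro sum.cong) (auto simp: power2_eq_square algebra_simps)
  also have "\<dots> = (\<Sum>x\<in>C. p x * (S x)\<^sup>2) - 2 * \<mu> * \<mu> + \<mu>\<^sup>2 * sum p C"
    by (simp add: sum.distrib sum_subtractf sum_distrib_left[symmetric] \<mu>_def)
  finally show ?thesis
    using assms by (simp add: \<mu>_def power2_eq_square)
qed

text \<open>The Loewner inequality is tested on the vector with entry \<open>z e c\<close> at
  \<open>(e, c)\<close>: the form of \<open>Cov\<close> becomes the variance on the left, and the
  form of \<open>Diag\<close> becomes the expected sum of squares on the right.\<close>

lemma spectrally_independent_variance_le:
  fixes z :: "'v set \<Rightarrow> nat \<Rightarrow> real"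
  assumes fB: "finite B" and fL: "\<And>e. e \<in> B \<Longrightarrow> finite (L e)"
    and si: "spectrally_independent K L B p" and p1: "sum p (colorings L B) = 1"
  shows "(\<Sum>\<tau>\<in>colorings L B. p \<tau> * ((\<Sum>e\<in>B. z e (\<tau> e)) -
           (\<Sum>\<sigma>\<in>colorings L B. p \<sigma> * (\<Sum>e\<in>B. z e (\<sigma> e))))\<^sup>2)
         \<le> K * (\<Sum>\<tau>\<in>colorings L B. p \<tau> * (\<Sum>e\<in>B. (z e (\<tau> e))\<^sup>2))"
proof -
  let ?C = "colorings L B"
  define X where "X = (SIGMA e:B. L e)"
  define I :: "'v set \<times> nat \<Rightarrow> ('v set \<Rightarrow> nat) \<Rightarrow> real"
    where "I a \<tau> = of_bool (\<tau> (fst a) = snd a)" for a \<tau>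
  define u where "u a = z (fst a) (snd a)" for a
  define \<mu> where "\<mu> a = (\<Sum>\<tau>\<in>?C. p \<tau> * I a \<tau>)" for a
  define M where "M a b = (\<Sum>\<tau>\<in>?C. p \<tau> * I a \<tau> * I b \<tau>)" for a b
  have fC: "finite ?C" using fB fL by (rule finite_colorings)
  have fX: "finite X" unfolding X_def using fB fL by auto
  \<comment> \<open>Since \<open>\<tau> e\<close> lies in \<open>L e\<close>, exactly one index
    \<open>(e, c)\<close> survives the indicator for each edge.\<close>
  have sumI: "(\<Sum>a\<in>X. I a \<tau> * y a) = (\<Sum>e\<in>B. y (e, \<tau> e))" if "\<tau> \<in> ?C" for \<tau> y
  proof -
    have "(\<Sum>a\<in>X. I a \<tau> * y a) = (\<Sum>e\<in>B. \<Sum>c\<in>L e. I (e, c) \<tau> * y (e, c))"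
      unfolding X_def using fB fL by (subst sum.Sigma) (auto intro!: sum.cong)
    also have "\<dots> = (\<Sum>e\<in>B. \<Sum>c\<in>L e. if \<tau> e = c then y (e, c) else 0)"
      by (intro sum.cong) (auto simp: I_def)
    also have "\<dots> = (\<Sum>e\<in>B. y (e, \<tau> e))"
      using fL coloring_in_list[OF that] by (intro sum.cong) auto
    finally show ?thesis .
  qed
  have em: "edge_mass L B p (fst a) (snd a) = \<mu> a" for a
    unfolding edge_mass_def mass_eq_sum_of_bool[OF fC] I_def \<mu>_def M_def by (simp add: mult.commute)
  have cov: "Cov L B p a b = M a b -
      \<mu> a * \<mu> b" for a b
  proof -
    have "mass L B p (\<lambda>\<tau>. \<tau> (fst a) = snd a \<and> \<tau> (fst b) = snd b) = M a b"
      unfolding mass_eq_sum_of_bool[OF fC] I_def \<mu>_def M_def by (intro sum.cong) auto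
    then show ?thesis
      using em[of a] em[of b] unfolding Cov_def by (simp add: case_prod_beta)
  qed
  have diag: "Diag L B p a b = (if a = b then \<mu> a else 0)" for a b
    using em[of a] unfolding Diag_def by (cases a; cases b) auto
  have lin: "(\<Sum>a\<in>X. u a * \<mu> a) = (\<Sum>\<tau>\<in>?C. p \<tau> * (\<Sum>e\<in>B. z e (\<tau> e)))"
  proof -
    have "(\<Sum>a\<in>X. u a * \<mu> a) = (\<Sum>\<tau>\<in>?C. \<Sum>a\<in>X. u a * (p \<tau> * I a \<tau>))"
      unfolding \<mu>_def sum_distrib_left by (rule sum.swap)
    also have "\<dots> = (\<Sum>\<tau>\<in>?C. p \<tau> * (\<Sum>a\<in>X. I a \<tau> * u a))"
      by (intro sum.cong) (auto simp: sum_distrib_left algebra_simps)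
    also have "\<dots> = (\<Sum>\<tau>\<in>?C. p \<tau> * (\<Sum>e\<in>B. z e (\<tau> e)))"
      by (intro sum.cong) (auto simp: sumI u_def)
    finally show ?thesis .
  qed
  have quad: "(\<Sum>a\<in>X. \<Sum>b\<in>X. u a * M a b * u b) =
      (\<Sum>\<tau>\<in>?C. p \<tau> * (\<Sum>e\<in>B. z e (\<tau> e))\<^sup>2)"
  proof -
    have "(\<Sum>a\<in>X. \<Sum>b\<in>X. u a * M a b * u b) =
        (\<Sum>a\<in>X. \<Sum>\<tau>\<in>?C. \<Sum>b\<in>X. u a * (p \<tau> * I a \<tau> * I b \<tau>) * u b)"
      unfolding M_def sum_distrib_left sum_distrib_right by (intro sum.cong refl sum.swap)
    also have "\<dots> = (\<Sum>\<tau>\<in>?C. \<Sum>a\<in>X. \<Sum>b\<in>X. u a * (p \<tau> * I a \<tau> * I b \<tau>) * u b)"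
      by (rule sum.swap)
    also have "\<dots> = (\<Sum>\<tau>\<in>?C. p \<tau> * ((\<Sum>a\<in>X. I a \<tau> * u a) * (\<Sum>b\<in>X. I b \<tau> * u b)))"
      unfolding sum_product unfolding sum_distrib_left
      by (intro sum.cong) (auto simp: algebra_simps)
    also have "\<dots> = (\<Sum>\<tau>\<in>?C. p \<tau> * (\<Sum>e\<in>B. z e (\<tau> e))\<^sup>2)"
      by (intro sum.cong) (auto simp: sumI u_def power2_eq_square)
    finally show ?thesis .
  qed
  have dg: "(\<Sum>a\<in>X. \<Sum>b\<in>X. u a * Diag L B p a b * u b) =
      (\<Sum>\<tau>\<in>?C. p \<tau> * (\<Sum>e\<in>B. (z e (\<tau> e))\<^sup>2))"
  proof -
    have "(\<Sum>a\<in>X. \<Sum>b\<in>X. u a * Diag L B p a b * u b) =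
        (\<Sum>a\<in>X. \<Sum>b\<in>X. if a = b then u a * \<mu> a * u b else 0)"
      unfolding diag by (intro sum.cong) auto
    also have "\<dots> = (\<Sum>a\<in>X. u a * \<mu> a * u a)"
      using fX by (intro sum.cong) auto
    also have "\<dots> = (\<Sum>\<tau>\<in>?C. \<Sum>a\<in>X. u a * (p \<tau> * I a \<tau>) * u a)"
      unfolding \<mu>_def sum_distrib_left sum_distrib_right by (rule sum.swap)
    also have "\<dots> = (\<Sum>\<tau>\<in>?C. p \<tau> * (\<Sum>a\<in>X. I a \<tau> * (u a)\<^sup>2))"
      by (intro sum.cong) (auto simp: sum_distrib_left power2_eq_square algebra_simps)
    also have "\<dots> = (\<Sum>\<tau>\<in>?C. p \<tau> * (\<Sum>e\<in>B. (z e (\<tau> e))\<^sup>2))"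
      by (intro sum.cong) (auto simp: sumI u_def)
    finally show ?thesis .
  qed
  have "0 \<le> (\<Sum>a\<in>X. \<Sum>b\<in>X. u a * (K * Diag L B p a b - Cov L B p a b) * u b)"
    using si unfolding spectrally_independent_def loewner_le_def psd_on_def X_def by blast
  \<comment> \<open>The product of marginals in \<open>Cov\<close> has rank one, so its form
    separates into the square of the mean.\<close>
  also have "(\<lambda>a b. u a * (K * Diag L B p a b - Cov L B p a b) * u b) =
      (\<lambda>a b. K * (u a * Diag L B p a b * u b) - u a * M a b * u b + (u a * \<mu> a) * (u b * \<mu> b))"
    unfolding cov by (intro ext) (simp add: algebra_simps)
  also have "(\<Sum>a\<in>X. \<Sum>b\<in>X. K * (u a * Diag L B p a b * u b) - u a * M a b * u b +
      (u a * \<mu> a) * (u b * \<mu> b)) = K * (\<Sum>a\<in>X. \<Sum>b\<in>X. u a * Diag L B p a b * u b) -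
      (\<Sum>a\<in>X. \<Sum>b\<in>X. u a * M a b * u b) + (\<Sum>a\<in>X. u a * \<mu> a) * (\<Sum>b\<in>X. u b * \<mu> b)"
    unfolding sum_product by (simp add: sum.distrib sum_subtractf sum_distrib_left)
  finally show ?thesis
    unfolding variance_eq[OF p1] lin quad dg by (simp add: power2_eq_square)
qed

text \<open>Pairing the deviations \<open>a c\<close> with themselves as test vector and applying Cauchy--Schwarz
  gives \<open>(\<Sum>c. (a c)\<^sup>2)\<^sup>2 \<le> (\<Sum>\<tau>. (x \<tau>)\<^sup>2) * Var\<close>, where spectral independence bounds the variance
  by \<open>K * P * (\<Sum>c. (a c)\<^sup>2)\<close>.\<close>

lemma spectrally_independent_color_deviation_le:
  fixes x :: "('v set \<Rightarrow> nat) \<Rightarrow> real"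
  assumes fB: "finite B" and fL: "\<And>e. e \<in> B \<Longrightarrow> finite (L e)" and fA: "finite A"
    and si: "spectrally_independent K L B p" and K: "K \<ge> 0"
    and dist: "distribution_on (colorings L B) p"
    and P0: "P \<ge> 0" and P: "\<And>c. c \<in> A \<Longrightarrow> color_mass L B p c \<le> P"
    and a: "\<And>c. c \<in> A \<Longrightarrow>
      a c = (\<Sum>\<tau>\<in>colorings L B. sqrt (p \<tau>) * x \<tau> * (of_bool (c \<in> \<tau> ` B) - color_mass L B p c))"
  shows "(\<Sum>c\<in>A. (a c)\<^sup>2) \<le> K * P * (\<Sum>\<tau>\<in>colorings L B. (x \<tau>)\<^sup>2)"
proof -
  let ?C = "colorings L B"
  \<comment> \<open>The test vector ignores the edge and vanishes outside \<open>A\<close>, so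
    \<open>S \<tau>\<close> adds up \<open>a c\<close> over the colors of \<open>A\<close> that
    \<open>\<tau>\<close> uses.\<close>
  define z where "z e c = (if c \<in> A then a c else 0)" for e :: "'v set" and c
  define S where "S \<tau> = (\<Sum>e\<in>B. z e (\<tau> e))" for \<tau>
  define Q where "Q = (\<Sum>c\<in>A. (a c)\<^sup>2)"
  define \<mu> where "\<mu> = (\<Sum>\<tau>\<in>?C. p \<tau> * S \<tau>)"
  have fC: "finite ?C" using fB fL by (rule finite_colorings)
  have p0: "p \<tau> \<ge> 0" if "\<tau> \<in> ?C" for \<tau> using dist that by (auto simp: distribution_on_def)
  have p1: "sum p ?C = 1" using dist by (auto simp: distribution_on_def)
  have cm: "color_mass L B p c = (\<Sum>\<tau>\<in>?C. p \<tau> * of_bool (c \<in> \<tau> ` B))" for c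
    unfolding color_mass_def mass_eq_sum_of_bool[OF fC] by (simp add: mult.commute)
  have S: "S \<tau> = (\<Sum>c\<in>A. of_bool (c \<in> \<tau> ` B) * a c)" if "\<tau> \<in> ?C" for \<tau>
    unfolding S_def z_def using that fB fA by (rule sum_coloring_eq_sum_used)
  have \<mu>: "\<mu> = (\<Sum>c\<in>A. color_mass L B p c * a c)"
  proof -
    have "\<mu> = (\<Sum>\<tau>\<in>?C. \<Sum>c\<in>A. p \<tau> * of_bool (c \<in> \<tau> ` B) * a c)"
      unfolding \<mu>_def by (intro sum.cong) (auto simp: S sum_distrib_left algebra_simps)
    also have "\<dots> = (\<Sum>c\<in>A. \<Sum>\<tau>\<in>?C. p \<tau> * of_bool (c \<in> \<tau> ` B) * a c)"
      by (rule sum.swap)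
    finally show ?thesis
      unfolding cm by (simp add: sum_distrib_right)
  qed
  \<comment> \<open>One factor of each square is expanded by the formula for \<open>a c\<close>;
    after exchanging the sums, the remaining factors assemble into
    \<open>S \<tau> - \<mu>\<close>.\<close>
  have Q_eq: "Q = (\<Sum>\<tau>\<in>?C. x \<tau> * (sqrt (p \<tau>) * (S \<tau> - \<mu>)))"
  proof -
    have "Q = (\<Sum>c\<in>A. \<Sum>\<tau>\<in>?C. sqrt (p \<tau>) * x \<tau> *
        (of_bool (c \<in> \<tau> ` B) - color_mass L B p c) * a c)"
      unfolding Q_def power2_eq_square sum_distrib_right[symmetric] using a by (intro sum.cong) auto
    also have "\<dots> = (\<Sum>\<tau>\<in>?C. \<Sum>c\<in>A. sqrt (p \<tau>) * x \<tau> *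
        (of_bool (c \<in> \<tau> ` B) - color_mass L B p c) * a c)"
      by (rule sum.swap)
    also have "\<dots> = (\<Sum>\<tau>\<in>?C. x \<tau> * (sqrt (p \<tau>) * (S \<tau> - \<mu>)))"
      unfolding \<mu>
      by (intro sum.cong refl)
         (simp only: S sum_subtractf[symmetric] sum_distrib_left, intro sum.cong refl,
          simp add: algebra_simps)
    finally show ?thesis .
  qed
  have "(\<Sum>\<tau>\<in>?C. p \<tau> * (\<Sum>e\<in>B. (z e (\<tau> e))\<^sup>2)) =
      (\<Sum>\<tau>\<in>?C. p \<tau> * (\<Sum>c\<in>A. of_bool (c \<in> \<tau> ` B) * (a c)\<^sup>2))"
  proof (intro sum.cong refl arg_cong2[of _ _ _ _ "(*)"])
    fix \<tau> assume \<tau>: "\<tau> \<in> ?C"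
    have "(\<Sum>e\<in>B. (z e (\<tau> e))\<^sup>2) = (\<Sum>e\<in>B. if \<tau> e \<in> A then (a (\<tau> e))\<^sup>2 else 0)"
      by (intro sum.cong) (auto simp: z_def)
    also have "\<dots> = (\<Sum>c\<in>A. of_bool (c \<in> \<tau> ` B) * (a c)\<^sup>2)"
      using \<tau> fB fA by (rule sum_coloring_eq_sum_used)
    finally show "(\<Sum>e\<in>B. (z e (\<tau> e))\<^sup>2) = (\<Sum>c\<in>A. of_bool (c \<in> \<tau> ` B) * (a c)\<^sup>2)" .
  qed
  also have "\<dots> = (\<Sum>\<tau>\<in>?C. \<Sum>c\<in>A. p \<tau> * of_bool (c \<in> \<tau> ` B) * (a c)\<^sup>2)"
    by (simp add: sum_distrib_left mult.assoc)
  also have "\<dots> = (\<Sum>c\<in>A. \<Sum>\<tau>\<in>?C. p \<tau> * of_bool (c \<in> \<tau> ` B) * (a c)\<^sup>2)"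
    by (rule sum.swap)
  also have "\<dots> = (\<Sum>c\<in>A. color_mass L B p c * (a c)\<^sup>2)"
    unfolding cm by (simp add: sum_distrib_right)
  also have "\<dots> \<le> (\<Sum>c\<in>A. P * (a c)\<^sup>2)"
    using P by (intro sum_mono mult_right_mono) auto
  also have "\<dots> = P * Q"
    by (simp add: Q_def sum_distrib_left)
  finally have diag: "(\<Sum>\<tau>\<in>?C. p \<tau> * (\<Sum>e\<in>B. (z e (\<tau> e))\<^sup>2)) \<le> P * Q" .
  have "(\<Sum>\<tau>\<in>?C. p \<tau> * (S \<tau> - \<mu>)\<^sup>2) \<le> K * (\<Sum>\<tau>\<in>?C. p \<tau> * (\<Sum>e\<in>B. (z e (\<tau> e))\<^sup>2))"
    using spectrally_independent_variance_le[OF fB fL si p1, of z] by (simp add: S_def \<mu>_def)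
  also have "\<dots> \<le> K * (P * Q)"
    using diag K by (rule mult_left_mono)
  finally have var: "(\<Sum>\<tau>\<in>?C. p \<tau> * (S \<tau> - \<mu>)\<^sup>2) \<le> K * P * Q" by (simp add: mult.assoc)
  have "Q * Q \<le> (\<Sum>\<tau>\<in>?C. (x \<tau>)\<^sup>2) * (\<Sum>\<tau>\<in>?C. (sqrt (p \<tau>) * (S \<tau> - \<mu>))\<^sup>2)"
    using Cauchy_Schwarz_ineq_sum[of x "\<lambda>\<tau>. sqrt (p \<tau>) * (S \<tau> - \<mu>)" ?C]
    unfolding Q_eq[symmetric] power2_eq_square[of Q] .
  also have "(\<Sum>\<tau>\<in>?C. (sqrt (p \<tau>) * (S \<tau> - \<mu>))\<^sup>2) = (\<Sum>\<tau>\<in>?C. p \<tau> * (S \<tau> - \<mu>)\<^sup>2)"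
    using p0 by (intro sum.cong) (auto simp: power_mult_distrib)
  also have "(\<Sum>\<tau>\<in>?C. (x \<tau>)\<^sup>2) * \<dots> \<le> (\<Sum>\<tau>\<in>?C. (x \<tau>)\<^sup>2) * (K * P * Q)"
    using var by (intro mult_left_mono sum_nonneg) auto
  finally have main: "Q * Q \<le> (K * P * (\<Sum>\<tau>\<in>?C. (x \<tau>)\<^sup>2)) * Q" by (simp add: algebra_simps)
  have "0 \<le> K * P * (\<Sum>\<tau>\<in>?C. (x \<tau>)\<^sup>2)"
    using K P0 by (intro mult_nonneg_nonneg sum_nonneg) auto
  moreover have "Q \<ge> 0" unfolding Q_def by (intro sum_nonneg) auto
  \<comment> \<open>\<open>Q\<close> cancels from \<open>main\<close> unless it is zero, and then
    the claim is nonnegativity of the right-hand side.\<close>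
  ultimately have "Q \<le> K * P * (\<Sum>\<tau>\<in>?C. (x \<tau>)\<^sup>2)"
    using main by (cases "Q = 0") auto
  then show ?thesis unfolding Q_def .
qed

section \<open>Differentiation in the coordinates given by \<open>phi\<close>\<close>

text \<open>The quotient rule turns the slopes \<open>g\<close> into \<open>f \<pi>\<close> times
  the deviation of \<open>g \<pi>\<close> from its mean. The chain rule contributes
  \<open>1 / sqrt (f \<pi>)\<close> from \<open>phi\<close> and \<open>sqrt p\<close> from
  \<open>phi_inv\<close>. Positivity of \<open>N\<close> keeps \<open>f \<pi>\<close> away from 0,
  where \<open>phi\<close> is not differentiable.\<close>

lemma deriv_phi_ratio:
  fixes N g :: "'a \<Rightarrow> real"
  assumes fin: "finite C" and N: "\<And>\<rho>. \<rho> \<in> C \<Longrightarrow> N \<rho> > 0" and \<pi>: "\<pi> \<in> C" and p: "p \<ge> 0"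
    and f: "\<And>\<rho>. f \<rho> = N \<rho> / sum N C"
  shows "deriv (\<lambda>t. phi (N \<pi> * (1 + g \<pi> * (phi_inv t - p)) /
           (\<Sum>\<rho>\<in>C. N \<rho> * (1 + g \<rho> * (phi_inv t - p))))) (phi p)
         = sqrt (f \<pi>) * sqrt p * (g \<pi> - (\<Sum>\<rho>\<in>C. f \<rho> * g \<rho>))"
proof -
  let ?Z = "sum N C"
  have Z: "?Z > 0" using fin N \<pi> by (intro sum_pos) auto
  define D where "D = (\<Sum>\<rho>\<in>C. N \<rho> * g \<rho>)"
  have f0: "f \<pi> > 0" using Z N[OF \<pi>] f by simp
  have Df: "(\<Sum>\<rho>\<in>C. f \<rho> * g \<rho>) = D / ?Z"
    unfolding D_def f by (simp add: sum_divide_distrib)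
  have d0: "((\<lambda>t. phi_inv t - p) has_real_derivative sqrt p) (at (phi p))"
    unfolding phi_inv_def by (auto intro!: derivative_eq_intros simp: phi_def)
  have dN: "((\<lambda>t. N \<rho> * (1 + g \<rho> * (phi_inv t - p))) has_real_derivative N \<rho> * g \<rho> * sqrt p)
      (at (phi p))" for \<rho>
    by (rule derivative_eq_intros d0 refl)+ simp
  have dZ: "((\<lambda>t. \<Sum>\<rho>\<in>C. N \<rho> * (1 + g \<rho> * (phi_inv t - p))) has_real_derivative D * sqrt p)
      (at (phi p))"
    unfolding D_def sum_distrib_right by (rule DERIV_sum) (rule dN)
  \<comment> \<open>At \<open>t = phi p\<close> the perturbation \<open>phi_inv t - p\<close>
    vanishes, so numerator and denominator there are just \<open>N \<pi>\<close> and
    \<open>?Z\<close>.\<close>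
  have dq: "((\<lambda>t. N \<pi> * (1 + g \<pi> * (phi_inv t - p)) /
      (\<Sum>\<rho>\<in>C. N \<rho> * (1 + g \<rho> * (phi_inv t - p)))) has_real_derivative
      (N \<pi> * g \<pi> * sqrt p * ?Z - N \<pi> * (D * sqrt p)) / (?Z * ?Z)) (at (phi p))"
    using DERIV_divide[OF dN[of \<pi>] dZ] Z p by (simp add: phi_inv_phi)
  have dphi: "(phi has_real_derivative 1 / sqrt (f \<pi>)) (at (f \<pi>))"
    unfolding phi_def using f0 by (auto intro!: derivative_eq_intros simp: field_simps)
  have at: "N \<pi> * (1 + g \<pi> * (phi_inv (phi p) - p)) /
      (\<Sum>\<rho>\<in>C. N \<rho> * (1 + g \<rho> * (phi_inv (phi p) - p))) = f \<pi>"
    using p by (simp add: phi_inv_phi f)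
  have "((\<lambda>t. phi (N \<pi> * (1 + g \<pi> * (phi_inv t - p)) /
      (\<Sum>\<rho>\<in>C. N \<rho> * (1 + g \<rho> * (phi_inv t - p))))) has_real_derivative
      1 / sqrt (f \<pi>) * ((N \<pi> * g \<pi> * sqrt p * ?Z - N \<pi> * (D * sqrt p)) / (?Z * ?Z))) (at (phi p))"
    using DERIV_chain2[OF _ dq, of phi "1 / sqrt (f \<pi>)"] dphi unfolding at by blast
  moreover have "1 / sqrt (f \<pi>) * ((N \<pi> * g \<pi> * sqrt p * ?Z - N \<pi> * (D * sqrt p)) / (?Z * ?Z)) =
      sqrt (f \<pi>) * sqrt p * (g \<pi> - (\<Sum>\<rho>\<in>C. f \<rho> * g \<rho>))"
  proof -
    have "(N \<pi> * g \<pi> * sqrt p * ?Z - N \<pi> * (D * sqrt p)) / (?Z * ?Z) =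
        f \<pi> * sqrt p * (g \<pi> - D / ?Z)"
      unfolding f using Z by (simp add: field_simps)
    moreover have "1 / sqrt (f \<pi>) * f \<pi> = sqrt (f \<pi>)"
      using f0 by (simp add: real_div_sqrt)
    ultimately show ?thesis unfolding Df by (metis mult.assoc)
  qed
  ultimately show ?thesis by (simp add: DERIV_imp_deriv)
qed

section \<open>Brooms and degrees\<close>

lemma children_edge:
  assumes "w \<in> children V E r u"
  shows "{u, w} \<in> E" and "w \<in> V"
  using assms unfolding children_def is_path_def
  by (auto simp: successively_append_iff)

lemma broom_subset_incident: "broom V E r u \<subseteq> {e \<in> E. u \<in> e}"
  unfolding broom_def using children_edge(1)[of _ V E r u] by blast

lemma card_broom_le_max_degree:
  assumes "finite V" and "finite E" and "u \<in> V"
  shows "card (broom V E r u) \<le> max_degree V E"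
proof -
  have "card (broom V E r u) \<le> vertex_degree E u"
    unfolding vertex_degree_def using assms(2) by (intro card_mono broom_subset_incident) auto
  also have "\<dots> \<le> max_degree V E"
    unfolding max_degree_def using assms by (intro Max_ge) auto
  finally show ?thesis .
qed

section \<open>Jacobian entries of the tree recursion\<close>

text \<open>The mass avoiding a color is linear in the single coordinate \<open>p i \<tau>\<close>.
  Varying that coordinate therefore multiplies each product \<open>N \<rho>\<close> by an affine
  factor with slope \<open>g \<rho>\<close>, which is the situation of
  \<open>deriv_phi_ratio\<close>.\<close>

lemma jacobian_entries_tree_rec_phi:
  fixes V :: "'v set" and E :: "'v set set" and L :: "'v set \<Rightarrow> nat set"
    and r :: 'v and d :: nat and v :: "nat \<Rightarrow> 'v" and p :: "nat \<Rightarrow> ('v set \<Rightarrow> nat) \<Rightarrow> real"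
  defines "B \<equiv> \<lambda>j. broom V E r (v j)" and "C \<equiv> colorings L (broom V E r r)"
    and "f \<equiv> tree_rec V E L r d v p"
  assumes fC: "finite C" and fB: "\<And>j. j \<in> {1..d} \<Longrightarrow> finite (colorings L (B j))"
    and pos: "\<And>\<rho> j. \<rho> \<in> C \<Longrightarrow> j \<in> {1..d} \<Longrightarrow> avoid_mass L (B j) (p j) (\<rho> {r, v j}) > 0"
    and p0: "\<And>j \<sigma>. j \<in> {1..d} \<Longrightarrow> \<sigma> \<in> colorings L (B j) \<Longrightarrow> p j \<sigma> \<ge> 0"
    and i: "i \<in> {1..d}" and \<tau>: "\<tau> \<in> colorings L (B i)" and \<pi>: "\<pi> \<in> C"
    and g: "\<And>\<rho>. g \<rho> = of_bool (\<rho> {r, v i} \<notin> \<tau> ` B i) / avoid_mass L (B i) (p i) (\<rho> {r, v i})"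
  shows "jacobian_entries (tree_rec_phi V E L r d v) (\<lambda>j \<sigma>. phi (p j \<sigma>)) \<pi> (i, \<tau>) =
    sqrt (f \<pi>) * sqrt (p i \<tau>) * (g \<pi> - (\<Sum>\<rho>\<in>C. f \<rho> * g \<rho>))"
proof -
  define m where "m j \<sigma> = phi (p j \<sigma>)" for j \<sigma>
  define A where "A j \<rho> = avoid_mass L (B j) (p j) (\<rho> {r, v j})" for j \<rho>
  define N where "N \<rho> = (\<Prod>j=1..d. A j \<rho>)" for \<rho>
  have N_pos: "N \<rho> > 0" if "\<rho> \<in> C" for \<rho>
    unfolding N_def A_def using pos[OF that] by (intro prod_pos) auto
  have fN: "f \<rho> = N \<rho> / sum N C" for \<rho>
    unfolding f_def tree_rec_def N_def A_def B_def C_def ..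
  have upd: "(\<Prod>j=1..d. avoid_mass L (B j) (\<lambda>\<sigma>. phi_inv ((m(i := (m i)(\<tau> := t))) j \<sigma>)) (\<rho> {r, v j})) =
      N \<rho> * (1 + g \<rho> * (phi_inv t - p i \<tau>))" if \<rho>: "\<rho> \<in> C" for \<rho> t
  proof -
    let ?A' = "\<lambda>j. avoid_mass L (B j) (\<lambda>\<sigma>. phi_inv ((m(i := (m i)(\<tau> := t))) j \<sigma>)) (\<rho> {r, v j})"
    have other: "?A' j = A j \<rho>" if "j \<in> {1..d} - {i}" for j
    proof -
      have "j \<in> {1..d}" "j \<noteq> i" using that by auto
      then show ?thesis
        unfolding A_def avoid_mass_def mass_eq_sum_of_bool[OF fB[OF \<open>j \<in> {1..d}\<close>]]
        using p0 by (intro sum.cong) (auto simp: m_def phi_inv_phi)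
    qed
    have self: "?A' i = A i \<rho> * (1 + g \<rho> * (phi_inv t - p i \<tau>))"
    proof -
      let ?b = "\<lambda>\<sigma>. of_bool (\<rho> {r, v i} \<notin> \<sigma> ` B i) :: real"
      have "?A' i = (\<Sum>\<sigma>\<in>colorings L (B i). ?b \<sigma> * p i \<sigma> +
          (if \<sigma> = \<tau> then ?b \<tau> * (phi_inv t - p i \<tau>) else 0))"
        unfolding avoid_mass_def mass_eq_sum_of_bool[OF fB[OF i]]
        using p0[OF i] by (intro sum.cong) (auto simp: m_def phi_inv_phi algebra_simps)
      also have "\<dots> = A i \<rho> + ?b \<tau> * (phi_inv t - p i \<tau>)"
        unfolding sum.distrib A_def avoid_mass_def mass_eq_sum_of_bool[OF fB[OF i]]
        using \<tau> fB[OF i] by simp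
      \<comment> \<open>Factoring out \<open>A i \<rho>\<close>, nonzero by \<open>pos\<close>, is
        what puts the division into \<open>g\<close>.\<close>
      also have "?b \<tau> = A i \<rho> * g \<rho>"
        unfolding g A_def using pos[OF \<rho> i] by simp
      finally show ?thesis by (simp add: algebra_simps)
    qed
    have "(\<Prod>j=1..d. ?A' j) = ?A' i * (\<Prod>j\<in>{1..d} - {i}. ?A' j)"
      using i by (intro prod.remove) auto
    also have "(\<Prod>j\<in>{1..d} - {i}. ?A' j) = (\<Prod>j\<in>{1..d} - {i}. A j \<rho>)"
      by (rule prod.cong[OF refl other])
    also have "?A' i * \<dots> = N \<rho> * (1 + g \<rho> * (phi_inv t - p i \<tau>))"
      unfolding self N_def using i by (subst (2) prod.remove[of _ i]) auto
    finally show ?thesis .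
  qed
  have "tree_rec_phi V E L r d v (m(i := (m i)(\<tau> := t))) \<pi> =
      phi (N \<pi> * (1 + g \<pi> * (phi_inv t - p i \<tau>)) /
        (\<Sum>\<rho>\<in>C. N \<rho> * (1 + g \<rho> * (phi_inv t - p i \<tau>))))" for t
    unfolding tree_rec_phi_def tree_rec_def C_def[symmetric] upd[unfolded B_def, OF \<pi>]
    using upd[unfolded B_def] by (simp cong: sum.cong)
  then have "jacobian_entries (tree_rec_phi V E L r d v) m \<pi> (i, \<tau>) =
      deriv (\<lambda>t. phi (N \<pi> * (1 + g \<pi> * (phi_inv t - p i \<tau>)) /
        (\<Sum>\<rho>\<in>C. N \<rho> * (1 + g \<rho> * (phi_inv t - p i \<tau>))))) (phi (p i \<tau>))"
    unfolding jacobian_entries_def by (simp add: m_def)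
  also have "\<dots> = sqrt (f \<pi>) * sqrt (p i \<tau>) * (g \<pi> - (\<Sum>\<rho>\<in>C. f \<rho> * g \<rho>))"
    using fC N_pos \<pi> p0[OF i \<tau>] fN by (rule deriv_phi_ratio)
  finally show ?thesis unfolding m_def .
qed

section \<open>Spectral norm of the Jacobian\<close>

theorem theorem5p8:
  fixes V :: "'v set" and E :: "'v set set" and L :: "'v set \<Rightarrow> nat set"
    and r :: 'v and v :: "nat \<Rightarrow> 'v" and q d \<Delta> :: nat and \<eta> \<delta> \<beta> :: real
    and p :: "nat \<Rightarrow> ('v set \<Rightarrow> nat) \<Rightarrow> real" and p\<^sub>r :: "('v set \<Rightarrow> nat) \<Rightarrow> real"
    and m :: "nat \<Rightarrow> ('v set \<Rightarrow> nat) \<Rightarrow> real"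
  assumes "\<eta> \<ge> 0" and "0 < \<delta>" and "\<delta> < 1 / 2"
    and "extra_instance \<beta> V E q L"
    and "max_degree V E = \<Delta>"
    and "r \<in> V"
    and "bij_betw v {1..d} (children V E r r)"
    and "\<beta> \<ge> 1 + (1 + \<eta>) * real \<Delta> / sqrt (1 - 2 * \<delta>)"
    and "\<And>i. i \<in> {1..d} \<Longrightarrow> distribution_on (colorings L (broom V E r (v i))) (p i)"
    and "p\<^sub>r = tree_rec V E L r d v p"
    and "\<And>i a. i \<in> {1..d} \<Longrightarrow> a \<in> {1..q} \<Longrightarrow>
           color_mass L (broom V E r (v i)) (p i) a
             \<le> real (card (broom V E r (v i))) / (\<beta> - 1 + real (card (broom V E r (v i))))"
    and "\<And>i a. i \<in> {1..d} \<Longrightarrow> a \<in> {1..q} \<Longrightarrow>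
           edge_mass L (broom V E r r) p\<^sub>r {r, v i} a / avoid_mass L (broom V E r (v i)) (p i) a
             \<le> 1 / (\<beta> - 1)"
    and "\<And>i. i \<in> {1..d} \<Longrightarrow> spectrally_independent (1 + \<eta>) L (broom V E r (v i)) (p i)"
    and "spectrally_independent (1 + \<eta>) L (broom V E r r) p\<^sub>r"
    and "m = (\<lambda>i \<tau>. phi (p i \<tau>))"
  shows "spectral_norm (colorings L (broom V E r r))
           (SIGMA i:{1..d}. colorings L (broom V E r (v i)))
           (jacobian_entries (tree_rec_phi V E L r d v) m)
         \<le> (1 - \<delta>) / sqrt (real \<Delta>)"
proof -
  define B where "B i = broom V E r (v i)" for i
  define Br where "Br = broom V E r r"
  define C where "C = colorings L Br"
  define D where "D i = colorings L (B i)" for i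
  define S where "S = (SIGMA i:{1..d}. D i)"
  define J where "J = jacobian_entries (tree_rec_phi V E L r d v) m"
  define K where "K = 1 + \<eta>"
  define A where "A i c = avoid_mass L (B i) (p i) c" for i c
  define e where "e i = {r, v i}" for i
  have K: "K > 0" using assms(1) by (simp add: K_def)

  have sg: "simple_graph V E" using assms(4) by (simp add: extra_instance_def is_tree_def)
  have fV: "finite V" using sg by (simp add: simple_graph_def)
  have fE: "finite E"
    using sg by (intro finite_subset[OF _ finite_Pow_iff[THEN iffD2, OF fV]])
      (auto simp: simple_graph_def)
  have LE: "L x \<subseteq> {1..q}" if "x \<in> E" for x
    using assms(4) that by (auto simp: extra_instance_def)
  have fLE: "finite (L x)" if "x \<in> E" for x
    using LE[OF that] by (rule finite_subset) simp
  have BE: "B i \<subseteq> E" for i using broom_subset_incident[of V E r "v i"] by (auto simp: B_def)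
  have BrE: "Br \<subseteq> E" using broom_subset_incident[of V E r r] by (auto simp: Br_def)
  have fB: "finite (B i)" for i using BE fE by (rule finite_subset)
  have fBr: "finite Br" using BrE fE by (rule finite_subset)
  have fLB: "finite (L x)" if "x \<in> B i" for x i using that BE fLE by blast
  have fLBr: "finite (L x)" if "x \<in> Br" for x using that BrE fLE by blast
  have fD: "finite (D i)" for i unfolding D_def using fB fLB by (rule finite_colorings)
  have fC: "finite C" unfolding C_def using fBr fLBr by (rule finite_colorings)
  have child: "v i \<in> children V E r r" if "i \<in> {1..d}" for i
    using assms(7) that by (auto simp: bij_betw_def)
  have eBr: "e i \<in> Br" if "i \<in> {1..d}" for i
    unfolding Br_def broom_def e_def using child[OF that] by blast
  have Br_image: "Br = e ` {1..d}"
  proof -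
    have "children V E r r = v ` {1..d}" using assms(7) by (simp add: bij_betw_def)
    then show ?thesis by (auto simp: Br_def broom_def e_def)
  qed
  have inj_e: "inj_on e {1..d}"
    using assms(7) unfolding bij_betw_def inj_on_def e_def by (metis doubleton_eq_iff)
  have sum_Br: "(\<Sum>x\<in>Br. F x) = (\<Sum>i=1..d. F (e i))" for F :: "'v set \<Rightarrow> real"
    unfolding Br_image using inj_e by (simp add: sum.reindex)
  have card_B: "card (B i) \<le> \<Delta>" if "i \<in> {1..d}" for i
    unfolding B_def assms(5)[symmetric]
    using fV fE children_edge(2)[OF child[OF that]] by (rule card_broom_le_max_degree)

  have bound0: "0 \<le> (1 - \<delta>) / sqrt (real \<Delta>)" using assms(3) by simp
  have "L2_set (\<lambda>\<pi>. \<Sum>b\<in>S. J \<pi> b * x b) C \<le> (1 - \<delta>) / sqrt (real \<Delta>)"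
    if x: "L2_set x S \<le> 1" for x
  \<comment> \<open>With no rows or no columns the product is 0. Otherwise the root has an edge, so
    \<open>\<Delta>\<close> is positive; the case \<open>\<Delta> = 0\<close>, where the bound reads
    0 by the convention for division, thus belongs to the first branch.\<close>
  proof (cases "C = {} \<or> d = 0")
    case True
    then have "L2_set (\<lambda>\<pi>. \<Sum>b\<in>S. J \<pi> b * x b) C = 0"
      by (auto simp: L2_set_def S_def)
    then show ?thesis using bound0 by simp
  next
    case False
    then have C: "C \<noteq> {}" and "1 \<in> {1..d}" by auto
    have "e 1 \<in> {y \<in> E. r \<in> y}"
      using eBr[OF \<open>1 \<in> {1..d}\<close>] BrE by (auto simp: e_def)
    then have "vertex_degree E r > 0"
      unfolding vertex_degree_def using fE by (auto simp: card_gt_0_iff)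
    also have "vertex_degree E r \<le> \<Delta>"
      unfolding assms(5)[symmetric] max_degree_def using fV assms(6) by (intro Max_ge) auto
    finally have \<Delta>: "real \<Delta> > 0" by simp
    define b where "b = \<beta> - 1"
    have b_ge: "b \<ge> K * real \<Delta> / sqrt (1 - 2 * \<delta>)"
      using assms(8) by (simp add: b_def K_def)
    moreover have "K * real \<Delta> / sqrt (1 - 2 * \<delta>) > 0"
      using K \<Delta> assms(3) by simp
    ultimately have b: "b > 0" by linarith

    \<comment> \<open>Marginal bounds and positivity of the recursion\<close>
    have p0: "p i \<tau> \<ge> 0" if "i \<in> {1..d}" "\<tau> \<in> D i" for i \<tau>
      using assms(9)[OF that(1)] that(2) by (auto simp: distribution_on_def D_def B_def)
    have p1: "sum (p i) (D i) = 1" if "i \<in> {1..d}" for i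
      using assms(9)[OF that(1)] by (auto simp: distribution_on_def D_def B_def)
    have eq1: "color_mass L (B i) (p i) c = 1 - A i c" if "i \<in> {1..d}" for i c
      using color_mass_add_avoid_mass[OF fD[of i, unfolded D_def], of "p i" c] p1[OF that]
      by (simp add: A_def D_def)
    have Lq: "c \<in> {1..q}" if "i \<in> {1..d}" "c \<in> L (e i)" for i c
      using LE[of "e i"] eBr[OF that(1)] BrE that(2) by blast
    have cm: "color_mass L (B i) (p i) c \<le> real (card (B i)) / (b + real (card (B i)))"
      if "i \<in> {1..d}" "c \<in> L (e i)" for i c
      using assms(11)[OF that(1) Lq[OF that]] by (simp add: B_def b_def)
    \<comment> \<open>The complement of the upper bound \<open>k / (b + k)\<close> on the mass of a
      color, with \<open>k\<close> the size of the broom; in particular all divisions by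
      \<open>A i c\<close> are genuine.\<close>
    have A_ge: "A i c \<ge> b / (b + real (card (B i)))" if "i \<in> {1..d}" "c \<in> L (e i)" for i c
    proof -
      have "1 - real (card (B i)) / (b + real (card (B i))) = b / (b + real (card (B i)))"
        using b by (simp add: field_simps)
      then show ?thesis using cm[OF that] eq1[OF that(1), of c] by linarith
    qed
    have A_pos: "A i c > 0" if "i \<in> {1..d}" "c \<in> L (e i)" for i c
    proof -
      have "b / (b + real (card (B i))) > 0" using b by (intro divide_pos_pos) auto
      then show ?thesis using A_ge[OF that] by linarith
    qed
    have CL: "\<pi> (e i) \<in> L (e i)" if "\<pi> \<in> C" "i \<in> {1..d}" for \<pi> i
      using that coloring_in_list eBr unfolding C_def by blast

    define N where "N \<rho> = (\<Prod>i=1..d. A i (\<rho> (e i)))" for \<rho>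
    have pr: "p\<^sub>r \<rho> = N \<rho> / sum N C" for \<rho>
      unfolding assms(10) tree_rec_def N_def A_def C_def Br_def B_def e_def ..
    have N_pos: "N \<rho> > 0" if "\<rho> \<in> C" for \<rho>
      unfolding N_def using A_pos CL[OF that] by (intro prod_pos) auto
    have Z: "sum N C > 0" using fC C N_pos by (intro sum_pos) auto
    have pr1: "sum p\<^sub>r C = 1"
      unfolding pr sum_divide_distrib[symmetric] using Z by simp
    have pr0: "p\<^sub>r \<rho> \<ge> 0" if "\<rho> \<in> C" for \<rho>
      unfolding pr using Z N_pos[OF that] by simp

    \<comment> \<open>The product with a test vector as a variance at the root\<close>
    \<comment> \<open>\<open>w\<close> absorbs the factor \<open>sqrt (p i \<tau>)\<close> of the
      Jacobian entry. Summing over \<open>\<tau>\<close> then leaves a function \<open>h i\<close>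
      of the color of \<open>e i\<close> alone, and \<open>G\<close> collects these over the
      children.\<close>
    define w where "w i \<tau> = sqrt (p i \<tau>) * x (i, \<tau>)" for i \<tau>
    define W where "W i = (\<Sum>\<tau>\<in>D i. w i \<tau>)" for i
    define h where "h i c = (\<Sum>\<tau>\<in>D i. w i \<tau> * of_bool (c \<notin> \<tau> ` B i)) / A i c" for i c
    define a where "a i c = (\<Sum>\<tau>\<in>D i. w i \<tau> * (of_bool (c \<in> \<tau> ` B i) - color_mass L (B i) (p i) c))"
      for i c
    define G where "G \<pi> = (\<Sum>i=1..d. h i (\<pi> (e i)))" for \<pi>
    define g where "g i \<tau> \<rho> = of_bool (\<rho> (e i) \<notin> \<tau> ` B i) / A i (\<rho> (e i))" for i \<tau> and \<rho> :: "'v set \<Rightarrow> nat"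
    have J: "J \<pi> (i, \<tau>) = sqrt (p\<^sub>r \<pi>) * sqrt (p i \<tau>) * (g i \<tau> \<pi> - (\<Sum>\<rho>\<in>C. p\<^sub>r \<rho> * g i \<tau> \<rho>))"
      if "\<pi> \<in> C" "i \<in> {1..d}" "\<tau> \<in> D i" for \<pi> i \<tau>
      unfolding J_def assms(15) assms(10) C_def Br_def
    proof (rule jacobian_entries_tree_rec_phi)
      show "finite (colorings L (broom V E r r))" using fC by (simp add: C_def Br_def)
      show "finite (colorings L (broom V E r (v j)))" for j using fD[of j] by (simp add: D_def B_def)
      show "avoid_mass L (broom V E r (v j)) (p j) (\<rho> {r, v j}) > 0"
        if "\<rho> \<in> colorings L (broom V E r r)" "j \<in> {1..d}" for \<rho> j
        using A_pos[OF that(2) CL[OF _ that(2)], of \<rho>] that(1)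
        by (simp add: A_def B_def C_def Br_def e_def)
      show "p j \<sigma> \<ge> 0" if "j \<in> {1..d}" "\<sigma> \<in> colorings L (broom V E r (v j))" for j \<sigma>
        using p0[of j \<sigma>] that by (simp add: D_def B_def)
    qed (use that in \<open>auto simp: C_def Br_def D_def B_def g_def e_def A_def\<close>)
    have sumg: "(\<Sum>i=1..d. \<Sum>\<tau>\<in>D i. w i \<tau> * g i \<tau> \<pi>) = G \<pi>" for \<pi>
      unfolding G_def h_def g_def sum_divide_distrib by (intro sum.cong) auto
    \<comment> \<open>Squaring and summing this over \<open>C\<close> gives exactly the variance of
      \<open>G\<close> under \<open>p\<^sub>r\<close>.\<close>
    have Jx: "(\<Sum>y\<in>S. J \<pi> y * x y) = sqrt (p\<^sub>r \<pi>) * (G \<pi> - (\<Sum>\<rho>\<in>C. p\<^sub>r \<rho> * G \<rho>))"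
      if "\<pi> \<in> C" for \<pi>
    proof -
      have "(\<Sum>y\<in>S. J \<pi> y * x y) = (\<Sum>i=1..d. \<Sum>\<tau>\<in>D i. J \<pi> (i, \<tau>) * x (i, \<tau>))"
        unfolding S_def using fD by (subst sum.Sigma) (auto intro!: sum.cong)
      also have "\<dots> = (\<Sum>i=1..d. \<Sum>\<tau>\<in>D i.
          sqrt (p\<^sub>r \<pi>) * (w i \<tau> * g i \<tau> \<pi> - (\<Sum>\<rho>\<in>C. p\<^sub>r \<rho> * (w i \<tau> * g i \<tau> \<rho>))))"
        by (intro sum.cong refl)
          (simp add: J[OF that] w_def sum_distrib_left sum_distrib_right algebra_simps)
      also have "\<dots> = sqrt (p\<^sub>r \<pi>) * ((\<Sum>i=1..d. \<Sum>\<tau>\<in>D i. w i \<tau> * g i \<tau> \<pi>) -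
          (\<Sum>i=1..d. \<Sum>\<tau>\<in>D i. \<Sum>\<rho>\<in>C. p\<^sub>r \<rho> * (w i \<tau> * g i \<tau> \<rho>)))"
        by (simp add: sum_distrib_left[symmetric] sum_subtractf)
      also have "(\<Sum>i=1..d. \<Sum>\<tau>\<in>D i. \<Sum>\<rho>\<in>C. p\<^sub>r \<rho> * (w i \<tau> * g i \<tau> \<rho>)) =
          (\<Sum>i=1..d. \<Sum>\<rho>\<in>C. \<Sum>\<tau>\<in>D i. p\<^sub>r \<rho> * (w i \<tau> * g i \<tau> \<rho>))"
        by (intro sum.cong refl sum.swap)
      also have "\<dots> = (\<Sum>\<rho>\<in>C. \<Sum>i=1..d. \<Sum>\<tau>\<in>D i. p\<^sub>r \<rho> * (w i \<tau> * g i \<tau> \<rho>))"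
        by (rule sum.swap)
      also have "\<dots> = (\<Sum>\<rho>\<in>C. p\<^sub>r \<rho> * G \<rho>)"
        by (simp only: sum_distrib_left[symmetric] sumg)
      finally show ?thesis by (simp only: sumg)
    qed

    \<comment> \<open>Centering \<open>h i\<close> by the constant \<open>W i\<close> leaves the variance unchanged, but is what makes the
      remaining sum over colors small.\<close>
    have h_eq: "h i c - W i = - a i c / A i c" if "i \<in> {1..d}" "c \<in> L (e i)" for i c
    proof -
      define T where "T = (\<Sum>\<tau>\<in>D i. w i \<tau> * of_bool (c \<in> \<tau> ` B i))"
      have "(\<Sum>\<tau>\<in>D i. w i \<tau> * of_bool (c \<notin> \<tau> ` B i)) = W i - T"
        unfolding W_def T_def sum_subtractf[symmetric] by (intro sum.cong) auto
      moreover have "a i c = T - W i * (1 - A i c)"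
        unfolding a_def T_def W_def eq1[OF that(1)]
        by (simp only: right_diff_distrib sum_subtractf sum_distrib_right)
      \<comment> \<open>Putting the right side over \<open>A i c\<close> gives the numerator
        \<open>W i - T - W i * A i c\<close>, which is \<open>- a i c\<close>.\<close>
      ultimately have "h i c - W i = (W i - T) / A i c - W i" and "a i c = T - W i * (1 - A i c)"
        by (simp_all add: h_def)
      then show ?thesis
        using A_pos[OF that] by (simp add: divide_simps) (simp add: algebra_simps)
    qed
    \<comment> \<open>The variance lemma indexes by edges of the broom, so the index of the child is
      recovered from its edge; \<open>inj_e\<close> makes this possible.\<close>
    define z where "z y c = (let i = the_inv_into {1..d} e y in h i c - W i)" for y c
    have z: "z (e i) c = h i c - W i" if "i \<in> {1..d}" for i c
      using the_inv_into_f_f[OF inj_e that] by (simp add: z_def Let_def)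
    define W' where "W' = (\<Sum>i=1..d. W i)"
    have Gz: "(\<Sum>y\<in>Br. z y (\<pi> y)) = G \<pi> - W'" for \<pi>
    proof -
      have "(\<Sum>y\<in>Br. z y (\<pi> y)) = (\<Sum>i=1..d. h i (\<pi> (e i)) - W i)"
        unfolding sum_Br using z by (intro sum.cong) auto
      then show ?thesis by (simp add: G_def W'_def sum_subtractf)
    qed
    \<comment> \<open>The square brings two factors \<open>1 / A i c\<close>. One is absorbed by the
      hypothesis on \<open>p\<^sub>r\<close>, at cost \<open>1 / b\<close>, the other costs
      \<open>(b + k) / b\<close> by \<open>A_ge\<close>. The deviation bound with
      \<open>P = k / (b + k)\<close> cancels \<open>b + k\<close> and leaves
      \<open>K * k / b\<^sup>2\<close>.\<close>
    have child_bound: "(\<Sum>\<pi>\<in>C. p\<^sub>r \<pi> * (z (e i) (\<pi> (e i)))\<^sup>2) \<le>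
        K * real \<Delta> / b\<^sup>2 * (\<Sum>\<tau>\<in>D i. (x (i, \<tau>))\<^sup>2)" if i: "i \<in> {1..d}" for i
    proof -
      define k where "k = real (card (B i))"
      define X where "X = (\<Sum>\<tau>\<in>D i. (x (i, \<tau>))\<^sup>2)"
      have X: "X \<ge> 0" unfolding X_def by (intro sum_nonneg) auto
      have k: "k \<ge> 0" "k \<le> real \<Delta>" using card_B[OF i] by (auto simp: k_def)
      have "(\<Sum>\<pi>\<in>C. p\<^sub>r \<pi> * (z (e i) (\<pi> (e i)))\<^sup>2) =
          (\<Sum>c\<in>L (e i). edge_mass L Br p\<^sub>r (e i) c * (z (e i) c)\<^sup>2)"
        unfolding C_def using fBr fLBr eBr[OF i] by (rule sum_coloring_eq_sum_edge_mass)
      also have "\<dots> \<le> (\<Sum>c\<in>L (e i). (b + k) / b\<^sup>2 * (a i c)\<^sup>2)"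
      proof (rule sum_mono)
        fix c assume c: "c \<in> L (e i)"
        have Ap: "A i c > 0" using i c by (rule A_pos)
        have "edge_mass L Br p\<^sub>r (e i) c / A i c \<le> 1 / b"
          using assms(12)[OF i Lq[OF i c]] by (simp add: Br_def e_def A_def B_def b_def)
        moreover have "1 / A i c \<le> (b + k) / b"
          using A_ge[OF i c] Ap b k by (simp add: k_def field_simps)
        ultimately have le: "edge_mass L Br p\<^sub>r (e i) c / A i c * (1 / A i c) \<le> 1 / b * ((b + k) / b)"
          using Ap b by (intro mult_mono) auto
        have "edge_mass L Br p\<^sub>r (e i) c * (z (e i) c)\<^sup>2 =
            edge_mass L Br p\<^sub>r (e i) c / A i c * (1 / A i c) * (a i c)\<^sup>2"
          unfolding z[OF i] h_eq[OF i c] by (simp add: power2_eq_square)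
        also have "\<dots> \<le> 1 / b * ((b + k) / b) * (a i c)\<^sup>2"
          using le by (rule mult_right_mono) simp
        finally show "edge_mass L Br p\<^sub>r (e i) c * (z (e i) c)\<^sup>2 \<le> (b + k) / b\<^sup>2 * (a i c)\<^sup>2"
          by (simp add: power2_eq_square)
      qed
      also have "\<dots> = (b + k) / b\<^sup>2 * (\<Sum>c\<in>L (e i). (a i c)\<^sup>2)"
        by (simp add: sum_distrib_left)
      also have "\<dots> \<le> (b + k) / b\<^sup>2 * (K * (k / (b + k)) * X)"
      proof (rule mult_left_mono)
        show "(\<Sum>c\<in>L (e i). (a i c)\<^sup>2) \<le> K * (k / (b + k)) * X"
          unfolding X_def D_def
        proof (rule spectrally_independent_color_deviation_le[where p = "p i" and B = "B i"])
          show "spectrally_independent K L (B i) (p i)"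
            using assms(13)[OF i] by (simp add: K_def B_def)
          show "distribution_on (colorings L (B i)) (p i)"
            using assms(9)[OF i] by (simp add: B_def)
          show "color_mass L (B i) (p i) c \<le> k / (b + k)" if "c \<in> L (e i)" for c
            using cm[OF i that] by (simp add: k_def)
        qed (use fB fLB fLBr[OF eBr[OF i]] K b k in \<open>auto simp: a_def w_def D_def\<close>)
      qed (use b k in auto)
      also have "\<dots> = K * k / b\<^sup>2 * X"
      proof -
        have "b + k \<noteq> 0" using b k by linarith
        then show ?thesis by simp
      qed
      also have "\<dots> \<le> K * real \<Delta> / b\<^sup>2 * X"
        using K k X by (intro mult_right_mono divide_right_mono mult_left_mono) auto
      finally show ?thesis unfolding X_def .
    qed

    \<comment> \<open>Combining the contributions of the children\<close>
    have sumx: "(\<Sum>i=1..d. \<Sum>\<tau>\<in>D i. (x (i, \<tau>))\<^sup>2) \<le> 1"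
    proof -
      have "(\<Sum>i=1..d. \<Sum>\<tau>\<in>D i. (x (i, \<tau>))\<^sup>2) = (\<Sum>y\<in>S. (x y)\<^sup>2)"
        unfolding S_def using fD by (subst sum.Sigma) (auto intro!: sum.cong)
      then show ?thesis using x by (simp add: L2_set_def)
    qed
    have "(L2_set (\<lambda>\<pi>. \<Sum>y\<in>S. J \<pi> y * x y) C)\<^sup>2 = (\<Sum>\<pi>\<in>C. (\<Sum>y\<in>S. J \<pi> y * x y)\<^sup>2)"
      unfolding L2_set_def by (intro real_sqrt_pow2 sum_nonneg) auto
    also have "\<dots> = (\<Sum>\<pi>\<in>C. p\<^sub>r \<pi> * (G \<pi> - (\<Sum>\<rho>\<in>C. p\<^sub>r \<rho> * G \<rho>))\<^sup>2)"
      using pr0 by (intro sum.cong refl) (simp add: Jx power_mult_distrib)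
    \<comment> \<open>The shift by \<open>W'\<close> also moves the mean by \<open>W'\<close>,
      because \<open>p\<^sub>r\<close> has total mass 1.\<close>
    also have "\<dots> = (\<Sum>\<pi>\<in>C. p\<^sub>r \<pi> * ((\<Sum>y\<in>Br. z y (\<pi> y)) - (\<Sum>\<rho>\<in>C. p\<^sub>r \<rho> * (\<Sum>y\<in>Br. z y (\<rho> y))))\<^sup>2)"
      using pr1 unfolding Gz
      by (simp add: right_diff_distrib sum_subtractf sum_distrib_right[symmetric])
    also have "\<dots> \<le> K * (\<Sum>\<pi>\<in>C. p\<^sub>r \<pi> * (\<Sum>y\<in>Br. (z y (\<pi> y))\<^sup>2))"
      unfolding C_def
    proof (rule spectrally_independent_variance_le)
      show "spectrally_independent K L Br p\<^sub>r" using assms(14) by (simp add: K_def Br_def)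
    qed (use fBr fLBr pr1 in \<open>auto simp: C_def\<close>)
    also have "(\<Sum>\<pi>\<in>C. p\<^sub>r \<pi> * (\<Sum>y\<in>Br. (z y (\<pi> y))\<^sup>2)) =
        (\<Sum>i=1..d. \<Sum>\<pi>\<in>C. p\<^sub>r \<pi> * (z (e i) (\<pi> (e i)))\<^sup>2)"
      unfolding sum_Br sum_distrib_left by (rule sum.swap)
    also have "K * \<dots> \<le> K * (\<Sum>i=1..d. K * real \<Delta> / b\<^sup>2 * (\<Sum>\<tau>\<in>D i. (x (i, \<tau>))\<^sup>2))"
      using K child_bound by (intro mult_left_mono sum_mono) auto
    also have "\<dots> = K * (K * real \<Delta> / b\<^sup>2 * (\<Sum>i=1..d. \<Sum>\<tau>\<in>D i. (x (i, \<tau>))\<^sup>2))"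
      by (simp add: sum_distrib_left)
    also have "\<dots> \<le> K * (K * real \<Delta> / b\<^sup>2 * 1)"
      using K sumx by (intro mult_left_mono) auto
    \<comment> \<open>Written this way, the quotient \<open>K * real \<Delta> / b\<close> is what
      the lower bound on \<open>\<beta>\<close> controls.\<close>
    also have "\<dots> = (K * real \<Delta> / b)\<^sup>2 / real \<Delta>"
      using \<Delta> b by (simp add: power2_eq_square)
    also have "\<dots> \<le> (sqrt (1 - 2 * \<delta>))\<^sup>2 / real \<Delta>"
    proof (intro divide_right_mono power_mono)
      show "K * real \<Delta> / b \<le> sqrt (1 - 2 * \<delta>)"
        using b_ge b assms(3) by (simp add: field_simps)
    qed (use K b in auto)
    \<comment> \<open>The two numerators differ by the square of \<open>\<delta>\<close>.\<close>
    also have "\<dots> \<le> (1 - \<delta>)\<^sup>2 / real \<Delta>"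
      using assms(3) by (intro divide_right_mono) (auto simp: power2_eq_square algebra_simps)
    also have "\<dots> = ((1 - \<delta>) / sqrt (real \<Delta>))\<^sup>2"
      by (simp add: power_divide)
    finally show ?thesis using bound0 by (rule power2_le_imp_le)
  qed
  then have "spectral_norm C S J \<le> (1 - \<delta>) / sqrt (real \<Delta>)"
    unfolding spectral_norm_def
    \<comment> \<open>The zero vector shows that the supremum is over a nonempty set.\<close>
    by (intro cSUP_least) (auto simp: L2_set_def intro!: exI[of _ "\<lambda>_. 0"])
  then show ?thesis
    unfolding C_def S_def D_def J_def Br_def B_def .
qed

end
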